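(* Let $b(X)$ be a $p\times1$ vector of functions of $X$ and let $\bar\gamma(X)=b(X)'\delta$, $\delta=(E[b(X)b(X)'])^{-1}E[b(X)Y]$, be the best linear predictor of $\gamma_0(X)$ by $b(X)$. If $E[b(X)b(X)']$ is nonsingular and $\alpha_0(X)=\rho_0'b(X)$ for some vector $\rho_0$, then $\theta_0=E[m(W,\bar\gamma)]$.
   Context: $W$ includes a scalar outcome $Y$ with $E[Y^2]<\infty$ and regressors $X$; $\gamma_0(X)=E[Y|X]$; the elements of $b(X)$ have finite second moments. $m(w,\gamma)$ is a functional linear in $\gamma$, $\theta_0=E[m(W,\gamma_0)]$, and $\alpha_0(X)$, with $E[\alpha_0(X)^2]<\infty$, is the Riesz representer: $E[m(W,\gamma)]=E[\alpha_0(X)\gamma(X)]$ for all $\gamma$ with $E[\gamma(X)^2]<\infty$. *)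

theory Defs
  imports "HOL-Probability.Probability"
begin

definition sq_integrable_functions ::
    "'a measure \<Rightarrow> 'x measure \<Rightarrow> ('a \<Rightarrow> 'x) \<Rightarrow> ('x \<Rightarrow> real) set" where
  "sq_integrable_functions P MX X =
     {g \<in> borel_measurable MX. integrable P (\<lambda>\<omega>. (g (X \<omega>))\<^sup>2)}"

text \<open>The regression function is a function on the range space of X, determined only up to
  null sets of the law of X.\<close>

definition is_regression_function ::
    "'a measure \<Rightarrow> 'x measure \<Rightarrow> ('a \<Rightarrow> 'x) \<Rightarrow> ('a \<Rightarrow> real) \<Rightarrow> ('x \<Rightarrow> real) \<Rightarrow> bool" where
  "is_regression_function P MX X Y g \<longleftrightarrow>
     g \<in> borel_measurable MX \<and>
     (AE \<omega> in P. g (X \<omega>) = real_cond_exp P (vimage_algebra (space P) X MX) Y \<omega>)"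

definition linear_functional_on :: "('x \<Rightarrow> real) set \<Rightarrow> (('x \<Rightarrow> real) \<Rightarrow> real) \<Rightarrow> bool" where
  "linear_functional_on L F \<longleftrightarrow>
     (\<forall>f\<in>L. \<forall>g\<in>L. F (\<lambda>x. f x + g x) = F f + F g) \<and>
     (\<forall>c. \<forall>f\<in>L. F (\<lambda>x. c * f x) = c * F f)"

text \<open>Integrability is spelled out because the Bochner integral of a non-integrable function
  is 0; it says that the expectation of m(W, g) exists.\<close>

definition is_riesz_representer ::
    "'a measure \<Rightarrow> 'x measure \<Rightarrow> ('a \<Rightarrow> 'w) \<Rightarrow> ('a \<Rightarrow> 'x) \<Rightarrow>
     ('w \<Rightarrow> ('x \<Rightarrow> real) \<Rightarrow> real) \<Rightarrow> ('x \<Rightarrow> real) \<Rightarrow> bool" where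
  "is_riesz_representer P MX W X m \<alpha> \<longleftrightarrow>
     \<alpha> \<in> sq_integrable_functions P MX X \<and>
     (\<forall>g \<in> sq_integrable_functions P MX X.
        integrable P (\<lambda>\<omega>. m (W \<omega>) g) \<and>
        (\<integral>\<omega>. m (W \<omega>) g \<partial>P) = (\<integral>\<omega>. \<alpha> (X \<omega>) * g (X \<omega>) \<partial>P))"

definition second_moment_matrix ::
    "'a measure \<Rightarrow> ('a \<Rightarrow> real^'p) \<Rightarrow> real^'p^'p" where
  "second_moment_matrix P B = (\<chi> i j. \<integral>\<omega>. B \<omega> $ i * B \<omega> $ j \<partial>P)"

definition cross_moment_vector ::
    "'a measure \<Rightarrow> ('a \<Rightarrow> real^'p) \<Rightarrow> ('a \<Rightarrow> real) \<Rightarrow> real^'p" where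
  "cross_moment_vector P B Y = (\<chi> i. \<integral>\<omega>. B \<omega> $ i * Y \<omega> \<partial>P)"

text \<open>Meaningful only if the second moment matrix is invertible.\<close>

definition blp_coefficient ::
    "'a measure \<Rightarrow> ('a \<Rightarrow> real^'p) \<Rightarrow> ('a \<Rightarrow> real) \<Rightarrow> real^'p" where
  "blp_coefficient P B Y = matrix_inv (second_moment_matrix P B) *v cross_moment_vector P B Y"

definition best_linear_predictor ::
    "'a measure \<Rightarrow> ('x \<Rightarrow> real^'p) \<Rightarrow> ('a \<Rightarrow> 'x) \<Rightarrow> ('a \<Rightarrow> real) \<Rightarrow> 'x \<Rightarrow> real" where
  "best_linear_predictor P b X Y = (\<lambda>x. b x \<bullet> blp_coefficient P (\<lambda>\<omega>. b (X \<omega>)) Y)"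

end

theory Submission
  imports Defs
begin

text \<open>The representer property turns both sides into expectations of products with
  \<open>\<alpha>\<^sub>0(X) = \<rho>\<^sub>0'b(X)\<close>: the left side is \<open>\<rho>\<^sub>0'E[b(X)\<gamma>\<^sub>0(X)] = \<rho>\<^sub>0'E[b(X)Y]\<close> by the tower property, the
  right side is \<open>\<rho>\<^sub>0'E[b(X)b(X)']\<delta>\<close>, and the normal equations \<open>E[b(X)b(X)']\<delta> = E[b(X)Y]\<close> identify
  the two.\<close>

text \<open>The dominating function comes from 2 |f g| \<le> f^2 + g^2; the factor 2 is dropped.
  This supplies integrability of every product of an entry of \<open>b (X \<omega>)\<close> with
  another entry, with the outcome, the regression function or the predictor.\<close>

lemma integrable_mult_of_square_integrable:
  fixes f g :: "'a \<Rightarrow> real"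
  assumes [measurable]: "f \<in> borel_measurable M" "g \<in> borel_measurable M"
    and "integrable M (\<lambda>x. (f x)\<^sup>2)" "integrable M (\<lambda>x. (g x)\<^sup>2)"
  shows "integrable M (\<lambda>x. f x * g x)"
proof (rule Bochner_Integration.integrable_bound)
  show "integrable M (\<lambda>x. (f x)\<^sup>2 + (g x)\<^sup>2)"
    using assms by simp
  show "AE x in M. norm (f x * g x) \<le> norm ((f x)\<^sup>2 + (g x)\<^sup>2)"
  proof (rule AE_I2)
    fix x
    have "2 * (\<bar>f x\<bar> * \<bar>g x\<bar>) \<le> (f x)\<^sup>2 + (g x)\<^sup>2"
      using sum_squares_bound[of "\<bar>f x\<bar>" "\<bar>g x\<bar>"] by (simp add: mult.assoc)
    moreover have "0 \<le> \<bar>f x\<bar> * \<bar>g x\<bar>" by simp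
    ultimately have "\<bar>f x\<bar> * \<bar>g x\<bar> \<le> (f x)\<^sup>2 + (g x)\<^sup>2" by linarith
    then show "norm (f x * g x) \<le> norm ((f x)\<^sup>2 + (g x)\<^sup>2)"
      by (simp add: abs_mult)
  qed
qed measurable

text \<open>Pointwise Cauchy-Schwarz: the square is at most |c|^2 |B|^2, and |B|^2 is the finite sum
  of the squared coordinates. It makes the linear predictor an admissible argument of the Riesz
  representer.\<close>

lemma square_integrable_inner_const:
  fixes B :: "'a \<Rightarrow> real^'p"
  assumes [measurable]: "B \<in> borel_measurable M"
    and B2: "\<And>i. integrable M (\<lambda>x. (B x $ i)\<^sup>2)"
  shows "integrable M (\<lambda>x. (B x \<bullet> c)\<^sup>2)"
proof (rule Bochner_Integration.integrable_bound)
  show "integrable M (\<lambda>x. (norm c)\<^sup>2 * (\<Sum>i\<in>UNIV. (B x $ i)\<^sup>2))"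
    using B2 by simp
  show "AE x in M. norm ((B x \<bullet> c)\<^sup>2) \<le> norm ((norm c)\<^sup>2 * (\<Sum>i\<in>UNIV. (B x $ i)\<^sup>2))"
  proof (rule AE_I2)
    fix x
    have "(\<Sum>i\<in>UNIV. (B x $ i)\<^sup>2) = B x \<bullet> B x"
      by (simp add: inner_vec_def power2_eq_square)
    then show "norm ((B x \<bullet> c)\<^sup>2) \<le> norm ((norm c)\<^sup>2 * (\<Sum>i\<in>UNIV. (B x $ i)\<^sup>2))"
      using Cauchy_Schwarz_ineq[of "B x" c]
      by (simp add: power2_norm_eq_inner mult.commute)
  qed
qed measurable

text \<open>Exchanging the finite sum with the integral requires each summand to be integrable,
  hence the coordinatewise hypothesis. The factor \<open>g\<close> is arbitrary so that the identity
  serves both the regression function and the predictor.\<close>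

lemma integral_inner_const_mult:
  fixes B :: "'a \<Rightarrow> real^'p" and g :: "'a \<Rightarrow> real"
  assumes "\<And>i. integrable M (\<lambda>x. B x $ i * g x)"
  shows "(\<integral>x. (c \<bullet> B x) * g x \<partial>M) = c \<bullet> cross_moment_vector M B g"
proof -
  have "(\<integral>x. (c \<bullet> B x) * g x \<partial>M) = (\<integral>x. (\<Sum>i\<in>UNIV. c $ i * (B x $ i * g x)) \<partial>M)"
    by (simp add: inner_vec_def sum_distrib_right mult.assoc)
  also have "\<dots> = c \<bullet> cross_moment_vector M B g"
    using assms by (simp add: cross_moment_vector_def inner_vec_def)
  finally show ?thesis .
qed

text \<open>Expanding the inner product inside the integral, E[B (B'd)] = E[B B'] d. With d the
  predictor's coefficient, the right side becomes the left side of the normal equations.\<close>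

lemma cross_moment_vector_inner_const:
  fixes B :: "'a \<Rightarrow> real^'p"
  assumes "\<And>i j. integrable M (\<lambda>x. B x $ i * B x $ j)"
  shows "cross_moment_vector M B (\<lambda>x. B x \<bullet> d) = second_moment_matrix M B *v d"
proof (rule vec_eq_iff[THEN iffD2], rule allI)
  fix i
  have "(\<integral>x. B x $ i * (B x \<bullet> d) \<partial>M) = (\<integral>x. (\<Sum>j\<in>UNIV. (B x $ i * B x $ j) * d $ j) \<partial>M)"
    by (simp add: inner_vec_def sum_distrib_left mult.assoc)
  also have "\<dots> = (\<Sum>j\<in>UNIV. (\<integral>x. B x $ i * B x $ j \<partial>M) * d $ j)"
    using assms by simp
  finally show "cross_moment_vector M B (\<lambda>x. B x \<bullet> d) $ i = (second_moment_matrix M B *v d) $ i"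
    by (simp add: cross_moment_vector_def second_moment_matrix_def matrix_vector_mult_def)
qed

text \<open>\<open>matrix_inv\<close> is a Hilbert choice of a two-sided inverse; invertibility
  provides the witness that makes the choice satisfy its specification.\<close>

lemma matrix_inv_right_invertible:
  assumes "invertible A"
  shows "A ** matrix_inv A = mat 1"
  using assms unfolding invertible_def matrix_inv_def by (metis (mono_tags, lifting) someI_ex)

lemma blp_normal_equations:
  assumes "invertible (second_moment_matrix P B)"
  shows "second_moment_matrix P B *v blp_coefficient P B Y = cross_moment_vector P B Y"
  using matrix_inv_right_invertible[OF assms]
  by (simp add: blp_coefficient_def matrix_vector_mul_assoc)

text \<open>Measurability of \<open>X\<close> puts the sigma-algebra it generates inside that of
  \<open>P\<close>; sigma-finiteness of the restriction is then automatic because \<open>P\<close>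
  is finite. This gives access to the theory of \<open>real_cond_exp\<close>.\<close>

lemma sigma_finite_subalgebra_vimage_algebra:
  assumes "prob_space P" "X \<in> measurable P MX"
  shows "sigma_finite_subalgebra P (vimage_algebra (space P) X MX)"
proof -
  interpret prob_space P by fact
  have "subalgebra P (vimage_algebra (space P) X MX)"
    using sets_image_in_sets[OF refl assms(2)] by (simp add: subalgebra_def)
  then have "finite_measure_subalgebra P (vimage_algebra (space P) X MX)"
    by unfold_locales
  then show ?thesis
    by (rule finite_measure_subalgebra_is_sigma_finite)
qed

text \<open>Conditional Jensen for the square.\<close>

lemma regression_function_sq_integrable:
  assumes P: "prob_space P" and X[measurable]: "X \<in> measurable P MX"
    and Y[measurable]: "Y \<in> borel_measurable P" and Y2: "integrable P (\<lambda>\<omega>. (Y \<omega>)\<^sup>2)"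
    and g: "is_regression_function P MX X Y g"
  shows "g \<in> sq_integrable_functions P MX X"
proof -
  interpret prob_space P by fact
  interpret sigma_finite_subalgebra P "vimage_algebra (space P) X MX"
    by (rule sigma_finite_subalgebra_vimage_algebra[OF P X])
  have gm[measurable]: "g \<in> borel_measurable MX"
    and ge: "AE \<omega> in P. g (X \<omega>) = real_cond_exp P (vimage_algebra (space P) X MX) Y \<omega>"
    using g by (auto simp: is_regression_function_def)
  have "integrable P (\<lambda>\<omega>. (real_cond_exp P (vimage_algebra (space P) X MX) Y \<omega>)\<^sup>2)"
  proof (rule integrable_convex_cond_exp[where I = UNIV])
    show "integrable P Y"
      using square_integrable_imp_integrable[OF Y Y2] .
    show "convex_on UNIV (\<lambda>x::real. x\<^sup>2)"
      by (rule convex_power_even) simp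
  qed (use Y2 in auto)
  \<comment> \<open>Jensen speaks of the conditional expectation itself, of which
    \<open>g (X \<omega>)\<close> is only an almost sure version.\<close>
  moreover have "AE \<omega> in P.
      (real_cond_exp P (vimage_algebra (space P) X MX) Y \<omega>)\<^sup>2 = (g (X \<omega>))\<^sup>2"
    using ge by eventually_elim simp
  ultimately have "integrable P (\<lambda>\<omega>. (g (X \<omega>))\<^sup>2)"
    by (subst integrable_cong_AE[symmetric]) simp_all
  then show ?thesis
    by (simp add: sq_integrable_functions_def)
qed

text \<open>Since \<open>h (X \<omega>)\<close> is measurable for the sigma-algebra generated by
  \<open>X\<close>, it can be moved inside the conditional expectation, and integrating removes the
  conditioning.\<close>

lemma integral_mult_regression_function:
  assumes P: "prob_space P" and X[measurable]: "X \<in> measurable P MX"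
    and Y[measurable]: "Y \<in> borel_measurable P"
    and g: "is_regression_function P MX X Y g"
    and h[measurable]: "h \<in> borel_measurable MX" and hY: "integrable P (\<lambda>\<omega>. h (X \<omega>) * Y \<omega>)"
  shows "(\<integral>\<omega>. h (X \<omega>) * g (X \<omega>) \<partial>P) = (\<integral>\<omega>. h (X \<omega>) * Y \<omega> \<partial>P)"
proof -
  let ?F = "vimage_algebra (space P) X MX"
  interpret sigma_finite_subalgebra P ?F
    by (rule sigma_finite_subalgebra_vimage_algebra[OF P X])
  have gm[measurable]: "g \<in> borel_measurable MX"
    and ge: "AE \<omega> in P. g (X \<omega>) = real_cond_exp P ?F Y \<omega>"
    using g by (auto simp: is_regression_function_def)
  have "X \<in> measurable ?F MX"
    by (rule measurable_vimage_algebra1) (use measurable_space[OF X] in auto)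
  then have hF: "(\<lambda>\<omega>. h (X \<omega>)) \<in> borel_measurable ?F"
    by simp
  have "(\<integral>\<omega>. h (X \<omega>) * g (X \<omega>) \<partial>P) = (\<integral>\<omega>. h (X \<omega>) * real_cond_exp P ?F Y \<omega> \<partial>P)"
    using ge by (intro integral_cong_AE) auto
  also have "\<dots> = (\<integral>\<omega>. h (X \<omega>) * Y \<omega> \<partial>P)"
    by (rule real_cond_exp_intg(2)[OF hY hF Y])
  finally show ?thesis .
qed

theorem theorem13:
  fixes P :: "'a measure" and MW :: "'w measure" and MX :: "'x measure"
    and W :: "'a \<Rightarrow> 'w" and X :: "'a \<Rightarrow> 'x" and Y :: "'a \<Rightarrow> real"
    and x_of :: "'w \<Rightarrow> 'x" and y_of :: "'w \<Rightarrow> real"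
    and m :: "'w \<Rightarrow> ('x \<Rightarrow> real) \<Rightarrow> real"
    and \<gamma>\<^sub>0 \<alpha>\<^sub>0 \<gamma>bar :: "'x \<Rightarrow> real" and \<theta>\<^sub>0 :: real
    and b :: "'x \<Rightarrow> real^'p"
  assumes "prob_space P"
    and "W \<in> measurable P MW"
    and "x_of \<in> measurable MW MX" and "X = (\<lambda>\<omega>. x_of (W \<omega>))"
    and "y_of \<in> borel_measurable MW" and "Y = (\<lambda>\<omega>. y_of (W \<omega>))"
    and "integrable P (\<lambda>\<omega>. (Y \<omega>)\<^sup>2)"
    and "is_regression_function P MX X Y \<gamma>\<^sub>0"
    and "\<And>w. w \<in> space MW \<Longrightarrow> linear_functional_on (sq_integrable_functions P MX X) (m w)"
    and "\<theta>\<^sub>0 = (\<integral>\<omega>. m (W \<omega>) \<gamma>\<^sub>0 \<partial>P)"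
    and "is_riesz_representer P MX W X m \<alpha>\<^sub>0"
    and "b \<in> borel_measurable MX"
    and "\<And>i. integrable P (\<lambda>\<omega>. (b (X \<omega>) $ i)\<^sup>2)"
    and "invertible (second_moment_matrix P (\<lambda>\<omega>. b (X \<omega>)))"
    and "\<gamma>bar = best_linear_predictor P b X Y"
    and "\<exists>\<rho>\<^sub>0 :: real^'p. AE \<omega> in P. \<alpha>\<^sub>0 (X \<omega>) = \<rho>\<^sub>0 \<bullet> b (X \<omega>)"
  shows "\<theta>\<^sub>0 = (\<integral>\<omega>. m (W \<omega>) \<gamma>bar \<partial>P)"
proof -
  define B where "B = (\<lambda>\<omega>. b (X \<omega>))"
  define \<delta> where "\<delta> = blp_coefficient P B Y"
  have X[measurable]: "X \<in> measurable P MX"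
    using assms(2,3) unfolding assms(4) by simp
  have Y[measurable]: "Y \<in> borel_measurable P"
    using assms(2,5) unfolding assms(6) by simp
  have b[measurable]: "b \<in> borel_measurable MX" by fact
  have B[measurable]: "B \<in> borel_measurable P" unfolding B_def by measurable
  have b_nth[measurable]: "(\<lambda>x. b x $ i) \<in> borel_measurable MX" for i
    by (rule borel_measurable_continuous_on[OF _ b]) (intro continuous_intros)
  have B_nth[measurable]: "(\<lambda>\<omega>. B \<omega> $ i) \<in> borel_measurable P" for i
    unfolding B_def by measurable
  have B2: "integrable P (\<lambda>\<omega>. (B \<omega> $ i)\<^sup>2)" for i
    using assms(13) by (simp add: B_def)
  have BB: "integrable P (\<lambda>\<omega>. B \<omega> $ i * B \<omega> $ j)" for i j
    by (rule integrable_mult_of_square_integrable) (use B2 in auto)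
  have BY: "integrable P (\<lambda>\<omega>. B \<omega> $ i * Y \<omega>)" for i
    by (rule integrable_mult_of_square_integrable) (use B2 assms(7) in auto)
  have \<gamma>\<^sub>0: "\<gamma>\<^sub>0 \<in> sq_integrable_functions P MX X"
    using regression_function_sq_integrable[OF assms(1) X Y assms(7,8)] .
  then have \<gamma>\<^sub>0_measurable[measurable]: "\<gamma>\<^sub>0 \<in> borel_measurable MX"
    and \<gamma>\<^sub>0_square: "integrable P (\<lambda>\<omega>. (\<gamma>\<^sub>0 (X \<omega>))\<^sup>2)"
    by (auto simp: sq_integrable_functions_def)
  have B\<gamma>\<^sub>0: "integrable P (\<lambda>\<omega>. B \<omega> $ i * \<gamma>\<^sub>0 (X \<omega>))" for i
    by (rule integrable_mult_of_square_integrable) (use B2 \<gamma>\<^sub>0_square in auto)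
  have \<gamma>bar_eq: "\<gamma>bar = (\<lambda>x. b x \<bullet> \<delta>)"
    by (simp add: assms(15) best_linear_predictor_def \<delta>_def B_def)
  have \<gamma>bar_X: "\<gamma>bar (X \<omega>) = B \<omega> \<bullet> \<delta>" for \<omega>
    by (simp add: \<gamma>bar_eq B_def)
  have \<gamma>bar_square: "integrable P (\<lambda>\<omega>. (B \<omega> \<bullet> \<delta>)\<^sup>2)"
    by (rule square_integrable_inner_const[OF B B2])
  \<comment> \<open>The first simplification settles square integrability in terms of
    \<open>B\<close>; the second settles measurability on \<open>MX\<close> from the explicit form
    in \<open>b\<close>.\<close>
  then have \<gamma>bar: "\<gamma>bar \<in> sq_integrable_functions P MX X"
    by (simp add: sq_integrable_functions_def \<gamma>bar_X) (simp add: \<gamma>bar_eq)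
  have B\<gamma>bar: "integrable P (\<lambda>\<omega>. B \<omega> $ i * (B \<omega> \<bullet> \<delta>))" for i
    by (rule integrable_mult_of_square_integrable) (use B2 \<gamma>bar_square in auto)
  obtain \<rho>\<^sub>0 :: "real^'p" where \<rho>\<^sub>0: "AE \<omega> in P. \<alpha>\<^sub>0 (X \<omega>) = \<rho>\<^sub>0 \<bullet> B \<omega>"
    using assms(16) by (auto simp: B_def)
  have \<alpha>\<^sub>0[measurable]: "\<alpha>\<^sub>0 \<in> borel_measurable MX"
    using assms(11) by (simp add: is_riesz_representer_def sq_integrable_functions_def)
  \<comment> \<open>Almost sure equality suffices to replace the representer under the integral.
    Afterwards the expectation depends on \<open>g\<close> only through its cross moments with
    \<open>b\<close>.\<close>
  have riesz: "(\<integral>\<omega>. m (W \<omega>) g \<partial>P) = (\<integral>\<omega>. (\<rho>\<^sub>0 \<bullet> B \<omega>) * g (X \<omega>) \<partial>P)"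
    if g: "g \<in> sq_integrable_functions P MX X" for g
  proof -
    have [measurable]: "g \<in> borel_measurable MX"
      using g by (simp add: sq_integrable_functions_def)
    have "(\<integral>\<omega>. m (W \<omega>) g \<partial>P) = (\<integral>\<omega>. \<alpha>\<^sub>0 (X \<omega>) * g (X \<omega>) \<partial>P)"
      using assms(11) g by (simp add: is_riesz_representer_def)
    also have "\<dots> = (\<integral>\<omega>. (\<rho>\<^sub>0 \<bullet> B \<omega>) * g (X \<omega>) \<partial>P)"
      using \<rho>\<^sub>0 by (intro integral_cong_AE) auto
    finally show ?thesis .
  qed
  \<comment> \<open>The tower property is applied once per coordinate, with \<open>h\<close> the
    i-th component of \<open>b\<close>.\<close>
  have tower: "cross_moment_vector P B (\<lambda>\<omega>. \<gamma>\<^sub>0 (X \<omega>)) = cross_moment_vector P B Y"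
  proof -
    have "(\<integral>\<omega>. b (X \<omega>) $ i * \<gamma>\<^sub>0 (X \<omega>) \<partial>P) = (\<integral>\<omega>. b (X \<omega>) $ i * Y \<omega> \<partial>P)" for i
      using BY unfolding B_def
      by (intro integral_mult_regression_function[OF assms(1) X Y assms(8)]) auto
    then show ?thesis
      by (simp add: cross_moment_vector_def B_def)
  qed
  have "\<theta>\<^sub>0 = \<rho>\<^sub>0 \<bullet> cross_moment_vector P B Y"
    using riesz[OF \<gamma>\<^sub>0] integral_inner_const_mult[OF B\<gamma>\<^sub>0] by (simp add: assms(10) tower)
  \<comment> \<open>The normal equations read backwards: the prediction residual is orthogonal to
    every entry of \<open>b\<close>, so outcome and predictor have the same cross moments.
    Nonsingularity enters here.\<close>
  also have "\<dots> = \<rho>\<^sub>0 \<bullet> cross_moment_vector P B (\<lambda>\<omega>. B \<omega> \<bullet> \<delta>)"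
    using blp_normal_equations[of P B Y] assms(14)
    by (simp add: cross_moment_vector_inner_const[OF BB] \<delta>_def flip: B_def)
  also have "\<dots> = (\<integral>\<omega>. m (W \<omega>) \<gamma>bar \<partial>P)"
    using riesz[OF \<gamma>bar] integral_inner_const_mult[OF B\<gamma>bar] by (simp add: \<gamma>bar_X)
  finally show ?thesis .
qed

end
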